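(* Let $q\ge2$ and $p\ge1$, and let $X_1,\dots,X_n$ be mean zero independent random vectors in $\mathbb{R}^p$, $X_i=(X_{i,1},\dots,X_{i,p})$. Suppose that for all $i\in\{1,\dots,n\}$, $$\mathbb{E}[\xi_i^q]<\infty,\quad\text{where}\quad \xi_i:=\max_{1\le j\le p}|X_{i,j}|.$$ If $V_{n,p}:=\max_{1\le j\le p}\sum_{i=1}^n\mathbb{E}[X_{i,j}^2]$, then $$\mathbb{E}\left[\max_{1\le j\le p}\left|\sum_{i=1}^nX_{i,j}\right|\right]\le\sqrt{6V_{n,p}\log(1+p)}+\sqrt2\,(3\log(1+p))^{1-1/q}\left(2\sum_{i=1}^n\mathbb{E}[\xi_i^q]\right)^{1/q}.$$ *)

theory Defs
  imports "HOL-Probability.Probability"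
begin

definition max_abs_coord :: "real ^ 'p \<Rightarrow> real" where
  "max_abs_coord x = (MAX j. \<bar>x $ j\<bar>)"

text \<open>The variance proxy is built from raw second moments, which are the coordinate variances
  only when the vectors have mean zero.\<close>

definition max_coord_second_moment ::
  "'a measure \<Rightarrow> nat \<Rightarrow> (nat \<Rightarrow> 'a \<Rightarrow> real ^ 'p) \<Rightarrow> real" where
  "max_coord_second_moment M n X = (MAX j. \<Sum>i=1..n. \<integral>\<omega>. (X i \<omega> $ j)\<^sup>2 \<partial>M)"

end

(* Truncate X_i to Y_i = X_i 1{xi_i <= B}. Since X_i is centred, the mean of Y_i and the expected
   remainder E max_j |X_i,j - Y_i,j| are each bounded by E[xi_i^q] / B^(q-1), so Y_i need not be recentred. With
   exp x <= 1 + x + x^2 for x <= 1, the 2p variables exp (+-l (sum of Y_i,j)), l <= 1/B, give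
   E max <= ln (2p) / l + l V + 2 (sum of E[xi_i^q]) / B^(q-1).
   Since (2p)^3 <= (1+p)^4, ln (2p) <= (4/3) ln (1+p); optimise in l, then take
   B^q = 2 (sum of E[xi_i^q]) / ln (1+p). The constants close because 4/3 + 1 <= sqrt 6. *)
theory Submission
  imports Defs
begin

text \<open>For negative x put y = -x. The claim then says that (1 - y + y^2) * exp y is at least 1,
  and replacing exp y by its quadratic Taylor lower bound leaves a polynomial in y with constant
  term 1 and nonnegative coefficients.\<close>

lemma exp_le_quadratic:
  fixes x :: real
  assumes "x \<le> 1"
  shows "exp x \<le> 1 + x + x\<^sup>2"
proof (cases "0 \<le> x")
  case True
  then show ?thesis using exp_bound assms by blast
next
  case False
  define y where "y = - x"
  have y: "0 \<le> y" using False by (simp add: y_def)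
  have nn: "0 \<le> 1 - y + y\<^sup>2"
    using zero_le_power2[of "y - 1 / 2"] by (simp add: power2_eq_square algebra_simps)
  have "(1 - y + y\<^sup>2) * (1 + y + y\<^sup>2 / 2) = 1 + y^2/2 + y^3/2 + y^4/2"
    by (simp add: field_simps power2_eq_square power3_eq_cube power4_eq_xxxx)
  also have "\<dots> \<ge> 1" using y by simp
  finally have "1 \<le> (1 - y + y\<^sup>2) * (1 + y + y\<^sup>2 / 2)" .
  also have "\<dots> \<le> (1 - y + y\<^sup>2) * exp y"
    by (intro mult_left_mono exp_lower_Taylor_quadratic y nn)
  finally have "exp (- y) \<le> 1 - y + y\<^sup>2"
    by (simp add: exp_minus field_simps)
  then show ?thesis by (simp add: y_def)
qed

section \<open>The maximum norm on coordinates and truncation by it\<close>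

lemma abs_nth_le_max_abs_coord: "\<bar>x $ j\<bar> \<le> max_abs_coord x"
  unfolding max_abs_coord_def by (rule Max_ge) auto

lemma max_abs_coord_attained: "\<exists>j. max_abs_coord x = \<bar>x $ j\<bar>"
proof -
  have "max_abs_coord x \<in> range (\<lambda>j. \<bar>x $ j\<bar>)"
    unfolding max_abs_coord_def by (rule Max_in) auto
  then show ?thesis by auto
qed

lemma max_abs_coord_le: "(\<And>j. \<bar>x $ j\<bar> \<le> c) \<Longrightarrow> max_abs_coord x \<le> c"
  using max_abs_coord_attained[of x] by auto

lemma max_abs_coord_nonneg: "0 \<le> max_abs_coord x"
  using abs_nth_le_max_abs_coord[of x] abs_ge_zero order_trans by blast

lemma max_abs_coord_zero [simp]: "max_abs_coord 0 = 0"
  using max_abs_coord_attained[of 0] by auto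

lemma max_abs_coord_add: "max_abs_coord (x + y) \<le> max_abs_coord x + max_abs_coord y"
proof (rule max_abs_coord_le)
  fix j
  show "\<bar>(x + y) $ j\<bar> \<le> max_abs_coord x + max_abs_coord y"
    using abs_nth_le_max_abs_coord[of x j] abs_nth_le_max_abs_coord[of y j] by simp
qed

lemma max_abs_coord_sum: "max_abs_coord (\<Sum>i\<in>I. f i) \<le> (\<Sum>i\<in>I. max_abs_coord (f i))"
proof (induction I rule: infinite_finite_induct)
  case (insert i I)
  then show ?case using max_abs_coord_add[of "f i" "sum f I"] by simp
qed auto

lemma borel_measurable_nth [measurable]: "(\<lambda>x::real^'p. x $ j) \<in> borel_measurable borel"
  by (intro borel_measurable_continuous_onI continuous_intros)

lemma borel_measurable_max_abs_coord [measurable]: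
  "(max_abs_coord :: real^'p \<Rightarrow> real) \<in> borel_measurable borel"
  unfolding max_abs_coord_def[abs_def] by (intro borel_measurable_Max) auto

text \<open>The whole vector is cut off at once, not each coordinate separately. The remainder
  \<open>x - trunc_vec B x\<close> is therefore either 0 or x, and one scalar event governs all
  coordinates.\<close>

definition trunc_vec :: "real \<Rightarrow> real ^ 'p \<Rightarrow> real ^ 'p" where
  "trunc_vec B x = (if max_abs_coord x \<le> B then x else 0)"

lemma borel_measurable_trunc_vec [measurable]:
  "(trunc_vec B :: real^'p \<Rightarrow> real^'p) \<in> borel_measurable borel"
  unfolding trunc_vec_def[abs_def] by measurable

lemma abs_trunc_vec_nth_le: "0 \<le> B \<Longrightarrow> \<bar>trunc_vec B x $ j\<bar> \<le> B"
  using abs_nth_le_max_abs_coord[of x j] by (auto simp: trunc_vec_def)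

text \<open>A pointwise Markov bound: the remainder is nonzero only where the norm m exceeds B, and
  there m^(q-1) / B^(q-1) is at least 1.\<close>

lemma max_abs_coord_trunc_vec_remainder:
  assumes "0 < B" "1 \<le> q"
  shows "max_abs_coord (x - trunc_vec B x) \<le> max_abs_coord x powr q / B powr (q - 1)"
proof (cases "max_abs_coord x \<le> B")
  case False
  define m where "m = max_abs_coord x"
  have m: "m > B" using False by (simp add: m_def)
  have "m * B powr (q - 1) \<le> m * m powr (q - 1)"
    using assms m by (intro mult_left_mono powr_mono2) auto
  also have "\<dots> = m powr q"
    using assms m by (simp add: powr_mult_base)
  finally have "m \<le> m powr q / B powr (q - 1)"
    using assms by (simp add: field_simps)
  then show ?thesis using False by (simp add: trunc_vec_def m_def)
qed (simp add: trunc_vec_def)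

section \<open>Exponential moments, expected maxima and truncated sums\<close>

context prob_space
begin

text \<open>After \<open>exp_le_quadratic\<close>, the inequality 1 + t <= exp t puts the bound into
  exponential form, so that it multiplies well over independent variables. The first moment is kept
  because truncated variables need not be centred.\<close>

lemma expectation_exp_le:
  fixes f :: "'a \<Rightarrow> real"
  assumes [measurable]: "random_variable borel f" and bd: "\<And>\<omega>. \<bar>f \<omega>\<bar> \<le> 1"
  shows "integrable M (\<lambda>\<omega>. exp (f \<omega>))"
    and "expectation (\<lambda>\<omega>. exp (f \<omega>)) \<le> exp (expectation f + expectation (\<lambda>\<omega>. (f \<omega>)\<^sup>2))"
proof -
  have bd1: "f \<omega> \<le> 1" for \<omega> using bd[of \<omega>] by linarith
  show int: "integrable M (\<lambda>\<omega>. exp (f \<omega>))"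
    by (rule integrable_const_bound[where B = "exp 1"]) (auto intro: bd1)
  have int1: "integrable M f"
    by (rule integrable_const_bound[where B = 1]) (auto intro: bd)
  have int2: "integrable M (\<lambda>\<omega>. (f \<omega>)\<^sup>2)"
    by (rule integrable_const_bound[where B = 1]) (auto simp: abs_square_le_1 bd)
  have "expectation (\<lambda>\<omega>. exp (f \<omega>)) \<le> expectation (\<lambda>\<omega>. 1 + f \<omega> + (f \<omega>)\<^sup>2)"
    using int int1 int2 by (intro integral_mono) (auto intro: exp_le_quadratic bd1)
  also have "\<dots> = 1 + (expectation f + expectation (\<lambda>\<omega>. (f \<omega>)\<^sup>2))"
    using int1 int2 by (simp add: prob_space)
  also have "\<dots> \<le> exp (expectation f + expectation (\<lambda>\<omega>. (f \<omega>)\<^sup>2))"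
    by (rule exp_ge_add_one_self)
  finally show "expectation (\<lambda>\<omega>. exp (f \<omega>)) \<le> exp (expectation f + expectation (\<lambda>\<omega>. (f \<omega>)\<^sup>2))" .
qed

text \<open>Independence factorises the expectation of the product of exponentials; the exponents of
  the single-variable bounds then add up.\<close>

lemma expectation_exp_sum_le:
  fixes f :: "'i \<Rightarrow> 'a \<Rightarrow> real"
  assumes fin: "finite I" and indep: "indep_vars (\<lambda>_. borel) f I"
    and bd: "\<And>i \<omega>. i \<in> I \<Longrightarrow> \<bar>f i \<omega>\<bar> \<le> 1"
  shows "integrable M (\<lambda>\<omega>. exp (\<Sum>i\<in>I. f i \<omega>))"
    and "expectation (\<lambda>\<omega>. exp (\<Sum>i\<in>I. f i \<omega>))
      \<le> exp (\<Sum>i\<in>I. expectation (f i) + expectation (\<lambda>\<omega>. (f i \<omega>)\<^sup>2))"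
proof -
  have rv: "random_variable borel (f i)" if "i \<in> I" for i
    using indep that by (auto simp: indep_vars_def)
  have ind: "indep_vars (\<lambda>_. borel) (\<lambda>i \<omega>. exp (f i \<omega>)) I"
    by (rule indep_vars_compose2[OF indep]) auto
  have int: "integrable M (\<lambda>\<omega>. exp (f i \<omega>))" if "i \<in> I" for i
    using expectation_exp_le(1)[OF rv bd] that by auto
  show "integrable M (\<lambda>\<omega>. exp (\<Sum>i\<in>I. f i \<omega>))"
    using indep_vars_integrable[OF fin ind int] by (simp add: exp_sum[OF fin])
  have "expectation (\<lambda>\<omega>. exp (\<Sum>i\<in>I. f i \<omega>)) = (\<Prod>i\<in>I. expectation (\<lambda>\<omega>. exp (f i \<omega>)))"
    using indep_vars_lebesgue_integral[OF fin ind int] by (simp add: exp_sum[OF fin])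
  also have "\<dots> \<le> (\<Prod>i\<in>I. exp (expectation (f i) + expectation (\<lambda>\<omega>. (f i \<omega>)\<^sup>2)))"
    using expectation_exp_le(2)[OF rv bd] by (intro prod_mono) auto
  also have "\<dots> = exp (\<Sum>i\<in>I. expectation (f i) + expectation (\<lambda>\<omega>. (f i \<omega>)\<^sup>2))"
    by (simp add: exp_sum[OF fin])
  finally show "expectation (\<lambda>\<omega>. exp (\<Sum>i\<in>I. f i \<omega>))
      \<le> exp (\<Sum>i\<in>I. expectation (f i) + expectation (\<lambda>\<omega>. (f i \<omega>)\<^sup>2))" .
qed

text \<open>The exponential of l times the maximum is at most the sum of 2p exponentials, one for
  each coordinate and sign. A logarithm of the expected sum costs only ln (2p).\<close>

lemma expectation_max_abs_coord_le_mgf: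
  fixes Y :: "'a \<Rightarrow> real ^ 'p"
  assumes l: "l > 0" and intY: "integrable M (\<lambda>\<omega>. max_abs_coord (Y \<omega>))"
    and int: "\<And>s j. s \<in> {1, -1} \<Longrightarrow> integrable M (\<lambda>\<omega>. exp (s * l * Y \<omega> $ j))"
    and mgf: "\<And>s j. s \<in> {1, -1} \<Longrightarrow> expectation (\<lambda>\<omega>. exp (s * l * Y \<omega> $ j)) \<le> exp c"
  shows "expectation (\<lambda>\<omega>. max_abs_coord (Y \<omega>)) \<le> (ln (2 * real CARD('p)) + c) / l"
proof -
  \<comment> \<open>\<open>exp a\<close> is 2p times \<open>exp c\<close>, the bound on the expected
    sum \<open>?E\<close>. With the tangent taken at a, the final estimate a - 1 + exp (-a) * exp a
    collapses to a.\<close>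
  define a where "a = ln (2 * real CARD('p)) + c"
  let ?E = "\<lambda>\<omega>. \<Sum>j\<in>UNIV. \<Sum>s\<in>{1,-1}. exp (s * l * Y \<omega> $ j)"
  have intE: "integrable M ?E"
    by (intro Bochner_Integration.integrable_sum int)
  have "expectation ?E = (\<Sum>j\<in>UNIV. \<Sum>s\<in>{1,-1}. expectation (\<lambda>\<omega>. exp (s * l * Y \<omega> $ j)))"
    by (subst Bochner_Integration.integral_sum, intro Bochner_Integration.integrable_sum int, assumption,
        subst Bochner_Integration.integral_sum) (auto intro: int)
  also have "\<dots> \<le> (\<Sum>j\<in>(UNIV :: 'p set). \<Sum>s\<in>{1,-1::real}. exp c)"
    by (intro sum_mono mgf)
  also have "\<dots> = exp a"
    by (simp add: a_def exp_add)
  finally have E: "expectation ?E \<le> exp a" .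
  \<comment> \<open>The tangent of exp at a replaces Jensen's inequality.\<close>
  have pw: "l * max_abs_coord (Y \<omega>) \<le> a - 1 + exp (- a) * ?E \<omega>" for \<omega>
  proof -
    obtain j where j: "max_abs_coord (Y \<omega>) = \<bar>Y \<omega> $ j\<bar>"
      using max_abs_coord_attained by blast
    have "exp (l * max_abs_coord (Y \<omega>)) \<le> (\<Sum>s\<in>{1,-1}. exp (s * l * Y \<omega> $ j))"
      unfolding j by (simp add: abs_if)
    also have "\<dots> \<le> ?E \<omega>"
      by (rule member_le_sum[of j UNIV "\<lambda>j. \<Sum>s\<in>{1,-1}. exp (s * l * Y \<omega> $ j)"]) (auto intro: sum_nonneg)
    finally have 1: "exp (l * max_abs_coord (Y \<omega>)) \<le> ?E \<omega>" .
    have "l * max_abs_coord (Y \<omega>) - a + 1 \<le> exp (l * max_abs_coord (Y \<omega>) - a)"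
      using exp_ge_add_one_self[of "l * max_abs_coord (Y \<omega>) - a"] by linarith
    also have "\<dots> = exp (- a) * exp (l * max_abs_coord (Y \<omega>))"
      by (simp add: exp_add[symmetric])
    also have "\<dots> \<le> exp (- a) * ?E \<omega>"
      using 1 by (intro mult_left_mono) auto
    finally show ?thesis by linarith
  qed
  have "l * expectation (\<lambda>\<omega>. max_abs_coord (Y \<omega>)) = expectation (\<lambda>\<omega>. l * max_abs_coord (Y \<omega>))"
    by simp
  also have "\<dots> \<le> expectation (\<lambda>\<omega>. a - 1 + exp (- a) * ?E \<omega>)"
    using intY intE pw by (intro integral_mono) auto
  also have "\<dots> = a - 1 + exp (- a) * expectation ?E"
    using intE by (subst Bochner_Integration.integral_add) (auto simp: prob_space)
  also have "\<dots> \<le> a - 1 + exp (- a) * exp a"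
    using E by (intro add_left_mono mult_left_mono) auto
  also have "\<dots> = a" by (simp add: exp_add[symmetric])
  finally show ?thesis using l by (simp add: a_def field_simps)
qed

text \<open>The factor 2 counts the truncation error twice: once as the drift of the uncentred
  truncated vectors in the exponential bound, once as the part that truncation discards.\<close>

lemma expectation_max_abs_coord_sum_le_trunc:
  fixes X :: "nat \<Rightarrow> 'a \<Rightarrow> real ^ 'p" and n :: nat and q :: real
  assumes q: "q \<ge> 2" and indep: "indep_vars (\<lambda>_. borel) X {1..n}"
    and mean: "\<And>i. i \<in> {1..n} \<Longrightarrow> has_bochner_integral M (X i) 0"
    and mom: "\<And>i. i \<in> {1..n} \<Longrightarrow> integrable M (\<lambda>\<omega>. max_abs_coord (X i \<omega>) powr q)"
    and B: "B > 0" and l: "l > 0" "l * B \<le> 1"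
  shows "expectation (\<lambda>\<omega>. max_abs_coord (\<Sum>i=1..n. X i \<omega>))
    \<le> ln (2 * real CARD('p)) / l + l * max_coord_second_moment M n X
      + 2 * (\<Sum>i=1..n. expectation (\<lambda>\<omega>. max_abs_coord (X i \<omega>) powr q)) / B powr (q - 1)"
proof -
  define Y where "Y i \<omega> = trunc_vec B (X i \<omega>)" for i \<omega>
  define \<tau> where "\<tau> i = expectation (\<lambda>\<omega>. max_abs_coord (X i \<omega>) powr q) / B powr (q - 1)" for i
  define V where "V = max_coord_second_moment M n X"
  have [measurable]: "random_variable borel (X i)" if "i \<in> {1..n}" for i
    using indep that by (auto simp: indep_vars_def)
  have [measurable]: "random_variable borel (Y i)" if "i \<in> {1..n}" for i
    unfolding Y_def using that by measurable
  have bdY: "\<bar>Y i \<omega> $ j\<bar> \<le> B" for i \<omega> j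
    unfolding Y_def using B by (intro abs_trunc_vec_nth_le) auto
  have intYj: "integrable M (\<lambda>\<omega>. Y i \<omega> $ j)" if "i \<in> {1..n}" for i j
    using that by (intro integrable_const_bound[where B = B]) (auto intro: bdY)
  have remainder: "max_abs_coord (X i \<omega> - Y i \<omega>) \<le> max_abs_coord (X i \<omega>) powr q / B powr (q - 1)"
    for i \<omega>
    unfolding Y_def using B q by (intro max_abs_coord_trunc_vec_remainder) auto
  have meanj: "has_bochner_integral M (\<lambda>\<omega>. X i \<omega> $ j) 0" if "i \<in> {1..n}" for i j
    using has_bochner_integral_bounded_linear[OF bounded_linear_vec_nth mean[OF that]] by simp
  \<comment> \<open>As X_i has mean zero, the mean of the truncated coordinate is minus the mean of
    the discarded part.\<close>
  have EY: "\<bar>expectation (\<lambda>\<omega>. Y i \<omega> $ j)\<bar> \<le> \<tau> i" if i: "i \<in> {1..n}" for i j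
  proof -
    have ix: "integrable M (\<lambda>\<omega>. X i \<omega> $ j)" "expectation (\<lambda>\<omega>. X i \<omega> $ j) = 0"
      using meanj[OF i] by (auto simp: has_bochner_integral_iff)
    have "expectation (\<lambda>\<omega>. Y i \<omega> $ j) = - expectation (\<lambda>\<omega>. X i \<omega> $ j - Y i \<omega> $ j)"
      using ix intYj[OF i] by simp
    then have "\<bar>expectation (\<lambda>\<omega>. Y i \<omega> $ j)\<bar> = \<bar>expectation (\<lambda>\<omega>. X i \<omega> $ j - Y i \<omega> $ j)\<bar>"
      by simp
    also have "\<dots> \<le> expectation (\<lambda>\<omega>. \<bar>X i \<omega> $ j - Y i \<omega> $ j\<bar>)"
      by (rule integral_abs_bound)
    also have "\<dots> \<le> expectation (\<lambda>\<omega>. max_abs_coord (X i \<omega>) powr q / B powr (q - 1))"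
    proof (rule integral_mono)
      fix \<omega>
      show "\<bar>X i \<omega> $ j - Y i \<omega> $ j\<bar> \<le> max_abs_coord (X i \<omega>) powr q / B powr (q - 1)"
        using order_trans[OF abs_nth_le_max_abs_coord[of "X i \<omega> - Y i \<omega>" j] remainder] by simp
    qed (use ix intYj[OF i] mom[OF i] in auto)
    finally show ?thesis by (simp add: \<tau>_def)
  qed
  have V: "(\<Sum>i=1..n. expectation (\<lambda>\<omega>. (Y i \<omega> $ j)\<^sup>2)) \<le> V" for j
  proof -
    have "expectation (\<lambda>\<omega>. (Y i \<omega> $ j)\<^sup>2) \<le> expectation (\<lambda>\<omega>. (X i \<omega> $ j)\<^sup>2)" if i: "i \<in> {1..n}" for i
    proof (rule integral_mono)
      \<comment> \<open>Since q >= 2, the q-th moment makes the squares integrable. This matters for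
        the comparison with V, because the integral of a non-integrable function defaults to
        0.\<close>
      have le: "(X i \<omega> $ j)\<^sup>2 \<le> 1 + max_abs_coord (X i \<omega>) powr q" for \<omega>
      proof -
        define m where "m = max_abs_coord (X i \<omega>)"
        have m: "0 \<le> m" "\<bar>X i \<omega> $ j\<bar> \<le> m"
          by (auto simp: m_def max_abs_coord_nonneg abs_nth_le_max_abs_coord)
        have "(X i \<omega> $ j)\<^sup>2 \<le> m\<^sup>2"
          using m by (simp add: abs_le_square_iff[symmetric])
        also have "\<dots> \<le> 1 + m powr q"
        proof (cases "m \<le> 1")
          case True
          then have "m\<^sup>2 \<le> 1" using m by (simp add: power_le_one)
          then show ?thesis using powr_ge_zero[of m q] by linarith
        next
          case False
          then have "m powr 2 \<le> m powr q" using q by (intro powr_mono) auto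
          then show ?thesis using False by (simp add: powr_numeral)
        qed
        finally show ?thesis by (simp add: m_def)
      qed
      show i2: "integrable M (\<lambda>\<omega>. (X i \<omega> $ j)\<^sup>2)"
        by (rule Bochner_Integration.integrable_bound[where f = "\<lambda>\<omega>. 1 + max_abs_coord (X i \<omega>) powr q"])
          (use i mom[OF i] le in auto)
      show "(Y i \<omega> $ j)\<^sup>2 \<le> (X i \<omega> $ j)\<^sup>2" for \<omega>
        by (simp add: Y_def trunc_vec_def)
      then show "integrable M (\<lambda>\<omega>. (Y i \<omega> $ j)\<^sup>2)"
        by (intro Bochner_Integration.integrable_bound[OF i2]) (use i in auto)
    qed
    then have "(\<Sum>i=1..n. expectation (\<lambda>\<omega>. (Y i \<omega> $ j)\<^sup>2))
        \<le> (\<Sum>i=1..n. expectation (\<lambda>\<omega>. (X i \<omega> $ j)\<^sup>2))"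
      by (intro sum_mono) auto
    also have "\<dots> \<le> V"
      unfolding V_def max_coord_second_moment_def by (rule Max_ge) auto
    finally show ?thesis .
  qed
  have intSY: "integrable M (\<lambda>\<omega>. max_abs_coord (\<Sum>i=1..n. Y i \<omega>))"
  proof (rule integrable_const_bound[where B = "real n * B"])
    have "max_abs_coord (\<Sum>i=1..n. Y i \<omega>) \<le> real n * B" for \<omega>
    proof -
      have "max_abs_coord (\<Sum>i=1..n. Y i \<omega>) \<le> (\<Sum>i=1..n. max_abs_coord (Y i \<omega>))"
        by (rule max_abs_coord_sum)
      also have "\<dots> \<le> (\<Sum>i=1..n. B)"
        by (intro sum_mono max_abs_coord_le bdY)
      finally show ?thesis by simp
    qed
    then show "AE \<omega> in M. norm (max_abs_coord (\<Sum>i=1..n. Y i \<omega>)) \<le> real n * B"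
      by (simp add: max_abs_coord_nonneg)
  qed measurable
  have mgf: "integrable M (\<lambda>\<omega>. exp (s * l * (\<Sum>i=1..n. Y i \<omega>) $ j)) \<and>
      expectation (\<lambda>\<omega>. exp (s * l * (\<Sum>i=1..n. Y i \<omega>) $ j)) \<le> exp (l * (\<Sum>i=1..n. \<tau> i) + l\<^sup>2 * V)"
    if s: "s \<in> {1, -1}" for s j
  proof -
    \<comment> \<open>The condition l * B <= 1 bounds each f_i by 1. The drift bound
      \<open>EY\<close> is two-sided, so l * \<tau> i serves both signs s, while the squares do not
      see the sign.\<close>
    define f where "f i \<omega> = s * l * Y i \<omega> $ j" for i \<omega>
    have ind: "indep_vars (\<lambda>_. borel) f {1..n}"
      unfolding f_def[abs_def] Y_def
      by (rule indep_vars_compose2[OF indep, where Y = "\<lambda>i x. s * l * trunc_vec B x $ j"]) measurable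
    have bd: "\<bar>f i \<omega>\<bar> \<le> 1" for i \<omega>
    proof -
      have "\<bar>f i \<omega>\<bar> = l * \<bar>Y i \<omega> $ j\<bar>"
        using s l by (auto simp: f_def abs_mult)
      also have "\<dots> \<le> l * B" using bdY l by (intro mult_left_mono) auto
      finally show ?thesis using l by linarith
    qed
    have f: "(\<Sum>i=1..n. f i \<omega>) = s * l * (\<Sum>i=1..n. Y i \<omega>) $ j" for \<omega>
      by (simp add: f_def sum_distrib_left)
    note mg = expectation_exp_sum_le[OF _ ind bd, unfolded f]
    have "expectation (f i) \<le> l * \<tau> i" if i: "i \<in> {1..n}" for i
    proof -
      have "expectation (f i) = s * l * expectation (\<lambda>\<omega>. Y i \<omega> $ j)"
        unfolding f_def[abs_def] by simp
      also have "\<dots> \<le> l * \<bar>expectation (\<lambda>\<omega>. Y i \<omega> $ j)\<bar>"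
        using s l by (auto simp: mult.assoc[symmetric] simp flip: mult_minus_right)
      also have "\<dots> \<le> l * \<tau> i" using EY[OF i] l by (intro mult_left_mono) auto
      finally show ?thesis .
    qed
    then have "(\<Sum>i=1..n. expectation (f i)) \<le> l * (\<Sum>i=1..n. \<tau> i)"
      unfolding sum_distrib_left by (intro sum_mono) auto
    moreover have "(\<Sum>i=1..n. expectation (\<lambda>\<omega>. (f i \<omega>)\<^sup>2)) \<le> l\<^sup>2 * V"
    proof -
      have "(\<Sum>i=1..n. expectation (\<lambda>\<omega>. (f i \<omega>)\<^sup>2)) = l\<^sup>2 * (\<Sum>i=1..n. expectation (\<lambda>\<omega>. (Y i \<omega> $ j)\<^sup>2))"
        using s by (auto simp: f_def power_mult_distrib sum_distrib_left)
      also have "\<dots> \<le> l\<^sup>2 * V" by (intro mult_left_mono V) auto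
      finally show ?thesis .
    qed
    ultimately have "exp (\<Sum>i=1..n. expectation (f i) + expectation (\<lambda>\<omega>. (f i \<omega>)\<^sup>2))
        \<le> exp (l * (\<Sum>i=1..n. \<tau> i) + l\<^sup>2 * V)"
      by (simp add: sum.distrib)
    with mg show ?thesis by (meson finite_atLeastAtMost order_trans)
  qed
  have "expectation (\<lambda>\<omega>. max_abs_coord (\<Sum>i=1..n. Y i \<omega>))
      \<le> (ln (2 * real CARD('p)) + (l * (\<Sum>i=1..n. \<tau> i) + l\<^sup>2 * V)) / l"
    using mgf by (intro expectation_max_abs_coord_le_mgf l intSY) auto
  also have "\<dots> = ln (2 * real CARD('p)) / l + (\<Sum>i=1..n. \<tau> i) + l * V"
    using l by (simp add: field_simps power2_eq_square)
  finally have EYle: "expectation (\<lambda>\<omega>. max_abs_coord (\<Sum>i=1..n. Y i \<omega>))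
      \<le> ln (2 * real CARD('p)) / l + (\<Sum>i=1..n. \<tau> i) + l * V" .
  let ?R = "\<lambda>\<omega>. \<Sum>i=1..n. max_abs_coord (X i \<omega>) powr q / B powr (q - 1)"
  have intR: "integrable M ?R"
    using mom by (intro Bochner_Integration.integrable_sum) auto
  have pw: "max_abs_coord (\<Sum>i=1..n. X i \<omega>) \<le> max_abs_coord (\<Sum>i=1..n. Y i \<omega>) + ?R \<omega>" for \<omega>
  proof -
    have "max_abs_coord (\<Sum>i=1..n. X i \<omega>)
        = max_abs_coord ((\<Sum>i=1..n. Y i \<omega>) + (\<Sum>i=1..n. X i \<omega> - Y i \<omega>))"
      by (simp add: sum_subtractf)
    also have "\<dots> \<le> max_abs_coord (\<Sum>i=1..n. Y i \<omega>) + max_abs_coord (\<Sum>i=1..n. X i \<omega> - Y i \<omega>)"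
      by (rule max_abs_coord_add)
    also have "max_abs_coord (\<Sum>i=1..n. X i \<omega> - Y i \<omega>) \<le> (\<Sum>i=1..n. max_abs_coord (X i \<omega> - Y i \<omega>))"
      by (rule max_abs_coord_sum)
    also have "\<dots> \<le> ?R \<omega>" by (intro sum_mono remainder)
    finally show ?thesis by simp
  qed
  \<comment> \<open>The majorant is integrable and nonnegative, which is what
    \<open>integral_mono'\<close> requires.\<close>
  have "expectation (\<lambda>\<omega>. max_abs_coord (\<Sum>i=1..n. X i \<omega>))
      \<le> expectation (\<lambda>\<omega>. max_abs_coord (\<Sum>i=1..n. Y i \<omega>) + ?R \<omega>)"
    using intSY intR pw
    by (intro integral_mono' Bochner_Integration.integrable_add add_nonneg_nonneg sum_nonneg)
      (auto simp: max_abs_coord_nonneg)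
  also have "\<dots> = expectation (\<lambda>\<omega>. max_abs_coord (\<Sum>i=1..n. Y i \<omega>)) + expectation ?R"
    using intSY intR by (rule Bochner_Integration.integral_add)
  also have "expectation ?R = (\<Sum>i=1..n. \<tau> i)"
    using mom by (subst Bochner_Integration.integral_sum) (auto simp: \<tau>_def)
  also have "expectation (\<lambda>\<omega>. max_abs_coord (\<Sum>i=1..n. Y i \<omega>)) + (\<Sum>i=1..n. \<tau> i)
      \<le> ln (2 * real CARD('p)) / l + l * V + 2 * (\<Sum>i=1..n. \<tau> i)"
    using EYle by linarith
  also have "2 * (\<Sum>i=1..n. \<tau> i)
      = 2 * (\<Sum>i=1..n. expectation (\<lambda>\<omega>. max_abs_coord (X i \<omega>) powr q)) / B powr (q - 1)"
    by (simp add: \<tau>_def flip: sum_divide_distrib)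
  finally show ?thesis by (simp add: V_def)
qed

end

section \<open>Constants and the choice of the scale l\<close>

lemma ln_double_le:
  assumes "p \<ge> (1::real)"
  shows "ln (2 * p) \<le> 4 / 3 * ln (1 + p)"
proof -
  \<comment> \<open>Comparing these two powers yields the factor 4 / 3 after taking logarithms; the
    difference is visibly nonnegative in this form.\<close>
  have "(1 + p) ^ 4 - (2 * p) ^ 3 = (p - 1) ^ 4 + 8 * p"
    by (simp add: algebra_simps power3_eq_cube power4_eq_xxxx)
  also have "\<dots> \<ge> 0" using assms by simp
  finally have "(2 * p) ^ 3 \<le> (1 + p) ^ 4" by simp
  then have "ln ((2 * p) ^ 3) \<le> ln ((1 + p) ^ 4)"
    using assms by (subst ln_le_cancel_iff) auto
  then have "3 * ln (2 * p) \<le> 4 * ln (1 + p)"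
    using assms ln_realpow[of "2 * p" 3] ln_realpow[of "1 + p" 4] by simp
  then show ?thesis by simp
qed

lemma max_coord_second_moment_nonneg: "0 \<le> max_coord_second_moment M n X"
proof -
  have "0 \<le> (\<Sum>i=1..n. \<integral>\<omega>. (X i \<omega> $ j)\<^sup>2 \<partial>M)" for j
    by (intro sum_nonneg) auto
  also have "(\<Sum>i=1..n. \<integral>\<omega>. (X i \<omega> $ j)\<^sup>2 \<partial>M) \<le> max_coord_second_moment M n X" for j
    unfolding max_coord_second_moment_def by (rule Max_ge) auto
  finally show ?thesis .
qed

text \<open>The free minimiser of h / l + l * V is sqrt (h / V), with value 2 * sqrt (h * V). It
  satisfies l * B <= 1 exactly when h * B^2 <= V. For smaller V the boundary value l = 1 / B is
  taken: then h / l is h * B, and V / B is at most sqrt (h * V). This case also absorbs V =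
  0.\<close>

lemma exists_balanced_scale:
  assumes V: "(V::real) \<ge> 0" and h: "h > 0" and B: "B > 0"
  shows "\<exists>l>0. l * B \<le> 1 \<and> h / l + l * V \<le> 2 * sqrt (h * V) + h * B"
proof (cases "V \<le> h * B\<^sup>2")
  case True
  have "V = sqrt V * sqrt V" using V by simp
  also have "\<dots> \<le> sqrt V * sqrt (h * B\<^sup>2)"
    using True V by (intro mult_left_mono) auto
  also have "\<dots> = sqrt (h * V) * B"
    using B by (simp add: real_sqrt_mult)
  also have "\<dots> \<le> 2 * sqrt (h * V) * B" using V h B by simp
  finally show ?thesis using B
    by (intro exI[of _ "1 / B"]) (simp add: field_simps)
next
  case False
  have V: "V > 0" using False h by (smt (verit) mult_nonneg_nonneg zero_le_power2)
  define l where "l = sqrt h / sqrt V"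
  have l: "l > 0" using V h by (simp add: l_def)
  have "sqrt h * B = sqrt (h * B\<^sup>2)" using B by (simp add: real_sqrt_mult)
  also have "\<dots> \<le> sqrt V" using False by simp
  finally have "l * B \<le> 1" using V by (simp add: l_def field_simps)
  moreover have "h / l = sqrt (h * V)" "l * V = sqrt (h * V)"
    using V h by (simp_all add: l_def real_sqrt_mult field_simps)
  ultimately show ?thesis using l h B by (intro exI[of _ l]) auto
qed

theorem propositionB1:
  fixes M :: "'a measure" and X :: "nat \<Rightarrow> 'a \<Rightarrow> real ^ 'p" and n :: nat and q :: real
  assumes "prob_space M"
    and "q \<ge> 2"
    and "prob_space.indep_vars M (\<lambda>_. borel) X {1..n}"
    and "\<And>i. i \<in> {1..n} \<Longrightarrow> has_bochner_integral M (X i) 0"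
    and "\<And>i. i \<in> {1..n} \<Longrightarrow> integrable M (\<lambda>\<omega>. max_abs_coord (X i \<omega>) powr q)"
  shows "(\<integral>\<omega>. max_abs_coord (\<Sum>i=1..n. X i \<omega>) \<partial>M)
    \<le> sqrt (6 * max_coord_second_moment M n X * ln (1 + real CARD('p)))
      + sqrt 2 * (3 * ln (1 + real CARD('p))) powr (1 - 1 / q)
        * (2 * (\<Sum>i=1..n. \<integral>\<omega>. max_abs_coord (X i \<omega>) powr q \<partial>M)) powr (1 / q)"
proof -
  interpret prob_space M by fact
  define L where "L = ln (1 + real CARD('p))"
  define V where "V = max_coord_second_moment M n X"
  define S where "S = (\<Sum>i=1..n. \<integral>\<omega>. max_abs_coord (X i \<omega>) powr q \<partial>M)"
  define T where "T = (\<integral>\<omega>. max_abs_coord (\<Sum>i=1..n. X i \<omega>) \<partial>M)"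
  have q: "q \<ge> 2" by fact
  have card: "real CARD('p) \<ge> 1" by (simp add: Suc_leI)
  have L: "L > 0" using card by (simp add: L_def)
  have V: "V \<ge> 0" by (simp add: V_def max_coord_second_moment_nonneg)
  have S: "S \<ge> 0" unfolding S_def by (intro sum_nonneg) auto
  \<comment> \<open>The scale l is already balanced here, with h = 4 / 3 * L. The threshold B stays
    free because S = 0 and S > 0 call for different choices.\<close>
  have main: "T \<le> sqrt (6 * V * L) + 4 / 3 * L * B + 2 * S / B powr (q - 1)" if B: "B > 0" for B
  proof -
    obtain l where l: "l > 0" "l * B \<le> 1"
      "(4 / 3 * L) / l + l * V \<le> 2 * sqrt (4 / 3 * L * V) + 4 / 3 * L * B"
      using exists_balanced_scale[of V "4 / 3 * L" B] V L B by auto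
    have "T \<le> ln (2 * real CARD('p)) / l + l * V + 2 * S / B powr (q - 1)"
      unfolding T_def V_def S_def
      using assms B l by (intro expectation_max_abs_coord_sum_le_trunc) auto
    also have "ln (2 * real CARD('p)) / l \<le> (4 / 3 * L) / l"
      using ln_double_le[OF card] l by (intro divide_right_mono) (auto simp: L_def)
    \<comment> \<open>Four times 4 / 3 is 16 / 3, which fits under the 6 of the variance
      term.\<close>
    also have "2 * sqrt (4 / 3 * L * V) = sqrt (16 / 3 * (L * V))"
      using real_sqrt_mult[of 4 "4 / 3 * L * V"] by simp
    moreover have "sqrt (16 / 3 * (L * V)) \<le> sqrt (6 * V * L)"
      using V L by (intro real_sqrt_le_mono) (auto simp: mult.commute mult.left_commute intro!: mult_right_mono)
    ultimately show ?thesis using l(3) by linarith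
  qed
  have "T \<le> sqrt (6 * V * L) + sqrt 2 * (3 * L) powr (1 - 1 / q) * (2 * S) powr (1 / q)"
  proof (cases "S = 0")
    case True
    \<comment> \<open>With S = 0 the truncation error vanishes, and this B makes the remaining
      linear term 4 / 3 * L * B equal to e. The formula for B used when S > 0 would give 0
      here.\<close>
    have "T \<le> sqrt (6 * V * L) + e" if "e > 0" for e
      using main[of "e / (4 / 3 * L)"] that L True by simp
    then have "T \<le> sqrt (6 * V * L)" by (rule field_le_epsilon)
    then show ?thesis using True q by simp
  next
    case False
    with S have S: "S > 0" by simp
    \<comment> \<open>Chosen so that the truncation error 2 S / B powr (q - 1) equals L B.\<close>
    define B where "B = (2 * S / L) powr (1 / q)"
    have B: "B > 0" using S L by (simp add: B_def)
    have Bq: "B powr q = 2 * S / L" using S L q by (simp add: B_def powr_powr)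
    have "B * B powr (q - 1) = B powr q" using B by (simp add: powr_mult_base)
    then have err: "2 * S / B powr (q - 1) = L * B"
      using Bq B L by (simp add: field_simps)
    have LB: "L * B = L powr (1 - 1 / q) * (2 * S) powr (1 / q)"
      using L S by (simp add: B_def powr_divide powr_diff)
    \<comment> \<open>The coefficient 7 / 3 is 4 / 3 from the linear term of \<open>main\<close>
      plus 1 from the truncation error; 49 / 9 <= 6 places it below sqrt 6. Since q >= 2, the
      exponent 1 - 1 / q is at least 1 / 2, so sqrt 3 can be replaced by 3 powr (1 - 1 / q).\<close>
    have "(sqrt 2 * sqrt 3 :: real)\<^sup>2 = 6" by (simp add: power_mult_distrib)
    then have "(7 / 3)\<^sup>2 \<le> (sqrt 2 * sqrt 3 :: real)\<^sup>2" by (simp add: power2_eq_square)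
    then have "7 / 3 \<le> sqrt 2 * sqrt (3::real)" by (rule power2_le_imp_le) simp
    also have "sqrt (3::real) \<le> 3 powr (1 - 1 / q)"
      using q by (simp add: powr_half_sqrt[symmetric] field_simps)
    finally have c: "7 / 3 \<le> sqrt 2 * 3 powr (1 - 1 / q)" by simp
    have "T \<le> sqrt (6 * V * L) + 7 / 3 * (L * B)"
      using main[OF B] err by linarith
    also have "7 / 3 * (L * B) \<le> (sqrt 2 * 3 powr (1 - 1 / q)) * (L * B)"
      using c L B by (intro mult_right_mono) auto
    also have "\<dots> = sqrt 2 * (3 * L) powr (1 - 1 / q) * (2 * S) powr (1 / q)"
      using L by (simp add: LB powr_mult)
    finally show ?thesis by simp
  qed
  then show ?thesis by (simp add: T_def V_def S_def L_def)
qed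

end
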